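(* Let $0<k\leq n$ be integers. A matrix $P\in\mathbb{H}^{k\times k}$ is $n$-admissible if, and only if, the eigenvalues of $P^*P$ belong to the interval $[0,1]$ and the multiplicity of the eigenvalue $1$ of $P^*P$ is greater than or equal to $2k-n$.
   Context: $\mathbb{H}$ denotes the quaternions, $\mathbb{H}^{m\times n}$ the set of $m\times n$ quaternionic matrices, and $M^*$ the conjugate transpose of $M$. $\mathbb{H}^n$ is a right $\mathbb{H}$-vector space with Hermitian product $\langle u,v\rangle=u^*v$. For $0<k\leq n$, the Stiefel manifold $X_{n,k}$ is the set of matrices $x\in\mathbb{H}^{n\times k}$ with $x^*x=I_k$. One writes $x=\begin{bmatrix}T\\ P\end{bmatrix}$ with $T\in\mathbb{H}^{(n-k)\times k}$ and $P\in\mathbb{H}^{k\times k}$, so that $x\in X_{n,k}$ means $T^*T+P^*P=I_k$. A matrix $P\in\mathbb{H}^{k\times k}$ is called $n$-admissible if there exists $T\in\mathbb{H}^{(n-k)\times k}$ such that $\begin{bmatrix}T\\ P\end{bmatrix}\in X_{n,k}$ (when $n=k$, $T$ is the empty matrix). The matrix $P^*P$ is Hermitian, so it is diagonalizable in an orthonormal basis of $\mathbb{H}^k$ with real eigenvalues (the squares of the singular values of $P$). The multiplicity of $1$ is the number of times it occurs among them, and it is $0$ if $1$ is not an eigenvalue. If $2k-n\le 0$ the multiplicity condition is automatically satisfied. *)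

theory Defs
  imports Complex_Main "HOL-Library.Multiset" "Jordan_Normal_Form.Matrix"
begin

section \<open>Quaternions\<close>

codatatype quat = Quat (QRe: real) (QIm1: real) (QIm2: real) (QIm3: real)

lemma quat_eq_iff:
  "x = y \<longleftrightarrow> QRe x = QRe y \<and> QIm1 x = QIm1 y \<and> QIm2 x = QIm2 y \<and> QIm3 x = QIm3 y"
  by (auto intro: quat.expand)

instantiation quat :: ab_group_add
begin

primcorec zero_quat where
  "QRe 0 = 0" | "QIm1 0 = 0" | "QIm2 0 = 0" | "QIm3 0 = 0"

primcorec plus_quat where
  "QRe (x + y) = QRe x + QRe y"
| "QIm1 (x + y) = QIm1 x + QIm1 y"
| "QIm2 (x + y) = QIm2 x + QIm2 y"
| "QIm3 (x + y) = QIm3 x + QIm3 y"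

primcorec uminus_quat where
  "QRe (- x) = - QRe x"
| "QIm1 (- x) = - QIm1 x"
| "QIm2 (- x) = - QIm2 x"
| "QIm3 (- x) = - QIm3 x"

primcorec minus_quat where
  "QRe (x - y) = QRe x - QRe y"
| "QIm1 (x - y) = QIm1 x - QIm1 y"
| "QIm2 (x - y) = QIm2 x - QIm2 y"
| "QIm3 (x - y) = QIm3 x - QIm3 y"

instance
  by standard (auto simp: quat_eq_iff)

end

instantiation quat :: ring_1
begin

primcorec one_quat where
  "QRe 1 = 1" | "QIm1 1 = 0" | "QIm2 1 = 0" | "QIm3 1 = 0"

primcorec times_quat where
  "QRe (x * y) = QRe x * QRe y - QIm1 x * QIm1 y - QIm2 x * QIm2 y - QIm3 x * QIm3 y"
| "QIm1 (x * y) = QRe x * QIm1 y + QIm1 x * QRe y + QIm2 x * QIm3 y - QIm3 x * QIm2 y"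
| "QIm2 (x * y) = QRe x * QIm2 y - QIm1 x * QIm3 y + QIm2 x * QRe y + QIm3 x * QIm1 y"
| "QIm3 (x * y) = QRe x * QIm3 y + QIm1 x * QIm2 y - QIm2 x * QIm1 y + QIm3 x * QRe y"

instance
  by standard (auto simp: quat_eq_iff algebra_simps)

end

instantiation quat :: real_algebra_1
begin

primcorec scaleR_quat where
  "QRe (scaleR r x) = r * QRe x"
| "QIm1 (scaleR r x) = r * QIm1 x"
| "QIm2 (scaleR r x) = r * QIm2 x"
| "QIm3 (scaleR r x) = r * QIm3 x"

instance
  by standard (auto simp: quat_eq_iff algebra_simps)

end

instantiation quat :: conjugate
begin

primcorec conjugate_quat where
  "QRe (conjugate x) = QRe x"
| "QIm1 (conjugate x) = - QIm1 x"
| "QIm2 (conjugate x) = - QIm2 x"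
| "QIm3 (conjugate x) = - QIm3 x"

instance
  by standard (auto simp: quat_eq_iff)

end

lemma conjugate_quat_mult: "conjugate (x * y) = conjugate y * conjugate (x :: quat)"
  by (simp add: quat_eq_iff algebra_simps)

lemma quat_conjugate_mult_self:
  "conjugate x * x = of_real ((QRe x)\<^sup>2 + (QIm1 x)\<^sup>2 + (QIm2 x)\<^sup>2 + (QIm3 x)\<^sup>2)"
  by (simp add: quat_eq_iff of_real_def power2_eq_square)

instantiation quat :: division_ring
begin

definition inverse_quat :: "quat \<Rightarrow> quat" where
  "inverse x = conjugate x /\<^sub>R ((QRe x)\<^sup>2 + (QIm1 x)\<^sup>2 + (QIm2 x)\<^sup>2 + (QIm3 x)\<^sup>2)"

definition "x div y = x * inverse y" for x y :: quat

instance
proof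
  fix x y :: quat
  define s where "s = (QRe x)\<^sup>2 + (QIm1 x)\<^sup>2 + (QIm2 x)\<^sup>2 + (QIm3 x)\<^sup>2"
  have inv: "inverse x = conjugate x /\<^sub>R s"
    by (simp add: inverse_quat_def s_def)
  have left: "conjugate x * x = of_real s"
    by (simp only: quat_conjugate_mult_self s_def)
  have right: "x * conjugate x = of_real s"
    by (simp add: quat_eq_iff of_real_def power2_eq_square s_def)
  assume "x \<noteq> 0"
  then have "s \<noteq> 0"
    unfolding s_def by (auto simp: quat_eq_iff add_nonneg_eq_0_iff)
  with left right show "inverse x * x = 1" "x * inverse x = 1"
    by (simp_all add: inv of_real_def)
next
  show "x div y = x * inverse y" for x y :: quat
    by (rule divide_quat_def)
  show "inverse (0 :: quat) = 0"
    by (simp add: inverse_quat_def quat_eq_iff)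
qed

end


section \<open>Quaternionic matrices\<close>

text \<open>
  The constant mat_adjoint of Jordan_Normal_Form requires a (commutative) field, so the conjugate
  transpose is defined here for any type with a conjugation.
\<close>

definition conj_transpose :: "'a :: conjugate mat \<Rightarrow> 'a mat" where
  "conj_transpose A = map_mat conjugate (transpose_mat A)"

definition stiefel :: "nat \<Rightarrow> nat \<Rightarrow> quat mat set" where
  "stiefel n k = {x \<in> carrier_mat n k. conj_transpose x * x = 1\<^sub>m k}"

definition admissible :: "nat \<Rightarrow> nat \<Rightarrow> quat mat \<Rightarrow> bool" where
  "admissible n k P \<longleftrightarrow>
     P \<in> carrier_mat k k \<and> (\<exists>T \<in> carrier_mat (n - k) k. T @\<^sub>r P \<in> stiefel n k)"

text \<open>
  \<open>\<bbbH>\<^sup>n\<close> is a right vector space, so scalars act on vectors from the right. (The scalar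
  multiplication of Jordan_Normal_Form multiplies from the left.)
\<close>

definition right_eigenvalue :: "quat mat \<Rightarrow> quat \<Rightarrow> bool" where
  "right_eigenvalue A \<mu> \<longleftrightarrow>
     (\<exists>v \<in> carrier_vec (dim_row A). v \<noteq> 0\<^sub>v (dim_row A) \<and> A *\<^sub>v v = map_vec (\<lambda>x. x * \<mu>) v)"

text \<open>
  The columns of \<open>U \<in> stiefel k k\<close> form an orthonormal basis of \<open>\<bbbH>\<^sup>k\<close>; the equation says that
  the \<open>i\<close>-th column is an eigenvector of \<open>A\<close> for the real eigenvalue \<open>ds ! i\<close>.
\<close>

definition orthonormal_diagonalization :: "quat mat \<Rightarrow> quat mat \<Rightarrow> real list \<Rightarrow> bool" where
  "orthonormal_diagonalization A U ds \<longleftrightarrow>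
     length ds = dim_row A \<and> U \<in> stiefel (dim_row A) (dim_row A) \<and>
     A * U = U * mat_diag (dim_row A) (\<lambda>i. of_real (ds ! i))"

text \<open>
  For Hermitian \<open>A\<close> such a diagonalization exists and its diagonal is unique up to order, so the
  description below determines a multiset. It is unspecified for other \<open>A\<close>.
\<close>

definition real_spectrum :: "quat mat \<Rightarrow> real multiset" where
  "real_spectrum A = (THE M. \<exists>U ds. orthonormal_diagonalization A U ds \<and> M = mset ds)"

definition eigenvalue_multiplicity :: "quat mat \<Rightarrow> real \<Rightarrow> nat" where
  "eigenvalue_multiplicity A r = count (real_spectrum A) r"

end

theory Submission
  imports Defs "Jordan_Normal_Form.Spectral_Radius"
begin

text \<open>
  The proposition says when \<open>I - P\<^sup>* P\<close> is a Gram matrix \<open>T\<^sup>* T\<close> of some \<open>T\<close> with \<open>n - k\<close> rows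
  (lemma \<open>admissible_iff_gram\<close>). A Hermitian matrix is such a Gram matrix iff its eigenvalues are
  nonnegative and at most \<open>n - k\<close> of them, counted with multiplicity, are nonzero. For
  \<open>I - P\<^sup>* P\<close> these eigenvalues are \<open>1 - d\<close>, with \<open>d\<close> running through those of \<open>P\<^sup>* P\<close>, which are
  nonnegative anyway. So the condition is that all \<open>d\<close> lie in \<open>[0,1]\<close> and that at most \<open>n - k\<close> of
  them differ from \<open>1\<close>, that is, that \<open>1\<close> has multiplicity at least \<open>k - (n - k) = 2k - n\<close>.

  In coordinates, let \<open>U\<close> be unitary with \<open>P\<^sup>* P U = U D\<close>. Given \<open>T\<close>, the columns of \<open>T U\<close> are
  orthogonal with squared norms \<open>1 - d\<close>, so the bound is the fact that \<open>m\<close>-dimensional space has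
  at most \<open>m\<close> nonzero pairwise orthogonal vectors (\<open>card_support_gram_le\<close>). Conversely, such norms
  are realized by multiples of distinct standard basis vectors (\<open>rdiag_gram_exists\<close>), and rotating
  them back by \<open>U\<^sup>*\<close> gives \<open>T\<close>.

  The bound on orthogonal families and the fact that \<open>U\<^sup>* U = I\<close> implies \<open>U U\<^sup>* = I\<close> for square \<open>U\<close>
  have the same source, a trace argument that works over the skew field. For a partial isometry
  \<open>X\<close>, the sum of all squared norms \<open>|x\<^sub>i\<^sub>j|\<^sup>2\<close> is computed in two ways: by columns it is the trace
  of \<open>X\<^sup>* X\<close>, and by rows it is the trace of the projection \<open>X X\<^sup>*\<close>, whose diagonal entries are at
  most \<open>1\<close>.

  The spectral theorem (\<open>hermitian_diagonalization\<close>) is proved by deflation. A right eigenvector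
  comes from a complex eigenvector of the \<open>2k \<times> 2k\<close> complex matrix of the same operator, its
  eigenvalue is real by Hermitian symmetry, and a Householder reflection moves a multiple of it to
  the first basis vector. The diagonal is unique up to order because the squared norms of the
  entries of the transition matrix between two eigenbases form a doubly stochastic matrix that
  links equal eigenvalues only (\<open>orthonormal_diagonalization_unique\<close>). Hence any one
  diagonalization computes the multiplicity as well as the right eigenvalues.
\<close>

section \<open>Quaternion arithmetic\<close>

lemma quat_of_real_sel [simp]:
  "QRe (of_real r) = r" "QIm1 (of_real r) = 0" "QIm2 (of_real r) = 0" "QIm3 (of_real r) = 0"
  by (simp_all add: of_real_def)

lemma conjugate_quat_of_real [simp]: "conjugate (of_real r :: quat) = of_real r"
  by (simp add: quat_eq_iff)

lemma conjugate_quat_zero [simp]: "conjugate (0 :: quat) = 0"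
  by (simp add: quat_eq_iff)

lemma conjugate_quat_eq_0_iff [simp]: "conjugate x = 0 \<longleftrightarrow> x = (0 :: quat)"
  by (simp add: quat_eq_iff)

lemma conjugate_quat_one [simp]: "conjugate (1 :: quat) = 1"
  by (simp add: quat_eq_iff)

lemma conjugate_quat_add: "conjugate (x + y) = conjugate x + conjugate (y :: quat)"
  by (simp add: quat_eq_iff)

lemma conjugate_quat_diff: "conjugate (x - y) = conjugate x - conjugate (y :: quat)"
  by (simp add: quat_eq_iff)

lemma conjugate_quat_sum: "conjugate (\<Sum>i\<in>I. f i) = (\<Sum>i\<in>I. conjugate (f i :: quat))"
  by (induction I rule: infinite_finite_induct) (simp_all add: conjugate_quat_add)

lemma quat_of_real_commute: "of_real r * x = x * (of_real r :: quat)"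
  by (simp add: quat_eq_iff)

lemma quat_eq_conjugateD: "conjugate x = x \<Longrightarrow> x = (of_real (QRe x) :: quat)"
  by (simp add: quat_eq_iff)

text \<open>
  The squared quaternion norm, kept real-valued so that sums over rows and columns of a matrix can be
  compared in an ordered field.
\<close>

definition nsq :: "quat \<Rightarrow> real" where
  "nsq x = (QRe x)\<^sup>2 + (QIm1 x)\<^sup>2 + (QIm2 x)\<^sup>2 + (QIm3 x)\<^sup>2"

lemma nsq_nonneg [simp]: "0 \<le> nsq x"
  by (simp add: nsq_def)

lemma nsq_eq_0_iff [simp]: "nsq x = 0 \<longleftrightarrow> x = 0"
  by (auto simp: nsq_def quat_eq_iff add_nonneg_eq_0_iff)

lemma nsq_zero [simp]: "nsq 0 = 0"
  by simp

lemma nsq_conjugate [simp]: "nsq (conjugate x) = nsq x"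
  by (simp add: nsq_def)

lemma nsq_of_real [simp]: "nsq (of_real r) = r\<^sup>2"
  by (simp add: nsq_def)

lemma nsq_mult: "nsq (x * y) = nsq x * nsq y"
  by (simp add: nsq_def power2_eq_square algebra_simps)

lemma conjugate_mult_self: "conjugate x * x = of_real (nsq x)"
  by (simp add: nsq_def quat_conjugate_mult_self)

lemma mult_conjugate_self: "x * conjugate x = of_real (nsq x)"
  using conjugate_mult_self[of "conjugate x"] by simp

section \<open>Conjugate transpose and diagonal matrices\<close>

lemma conj_transpose_dim [simp]:
  "dim_row (conj_transpose A) = dim_col A" "dim_col (conj_transpose A) = dim_row A"
  by (simp_all add: conj_transpose_def)

lemma conj_transpose_carrier [simp]:
  "A \<in> carrier_mat n m \<Longrightarrow> conj_transpose A \<in> carrier_mat m n"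
  by (simp add: conj_transpose_def)

lemma conj_transpose_index [simp]:
  "i < dim_col A \<Longrightarrow> j < dim_row A \<Longrightarrow> conj_transpose A $$ (i,j) = conjugate (A $$ (j,i))"
  by (simp add: conj_transpose_def)

lemma conj_transpose_conj_transpose [simp]: "conj_transpose (conj_transpose A) = A"
  by (rule eq_matI) auto

lemma index_mult_mat_sum:
  "i < dim_row A \<Longrightarrow> j < dim_col B \<Longrightarrow> dim_col A = dim_row B \<Longrightarrow>
   (A * B) $$ (i,j) = (\<Sum>l<dim_row B. A $$ (i,l) * B $$ (l,j))"
  by (auto simp: scalar_prod_def lessThan_atLeast0 intro!: sum.cong)

lemma conj_transpose_mult:
  "dim_col A = dim_row B \<Longrightarrow> conj_transpose (A * B) = conj_transpose B * conj_transpose (A :: quat mat)"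
  by (rule eq_matI)
     (auto simp: index_mult_mat_sum conjugate_quat_sum conjugate_quat_mult simp del: index_mult_mat(1)
       intro!: sum.cong)

lemma conj_transpose_diff:
  "dim_row A = dim_row B \<Longrightarrow> dim_col A = dim_col B \<Longrightarrow>
   conj_transpose (A - B) = conj_transpose A - conj_transpose (B :: quat mat)"
  by (rule eq_matI) (auto simp: conjugate_quat_diff)

lemma conj_transpose_one [simp]: "conj_transpose (1\<^sub>m k) = (1\<^sub>m k :: quat mat)"
  by (rule eq_matI) auto

text \<open>
  Associativity and distributivity with hypotheses on dimensions rather than on carriers, so that
  rewriting can discharge the side conditions.
\<close>

lemma mult_mat_assoc:
  "dim_col A = dim_row B \<Longrightarrow> dim_col B = dim_row C \<Longrightarrow> A * B * C = A * (B * (C :: quat mat))"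
  by (rule assoc_mult_mat[of A "dim_row A" "dim_row B" B "dim_row C" C "dim_col C"]) auto

lemma add_mult_mat_distrib:
  "dim_row A = dim_row B \<Longrightarrow> dim_col A = dim_col B \<Longrightarrow> dim_col B = dim_row C \<Longrightarrow>
   (A + B) * C = A * C + B * (C :: quat mat)"
  by (rule add_mult_distrib_mat[of A "dim_row B" "dim_col B" B C "dim_col C"]) auto

lemma mult_add_mat_distrib:
  "dim_col A = dim_row B \<Longrightarrow> dim_row B = dim_row C \<Longrightarrow> dim_col B = dim_col C \<Longrightarrow>
   A * (B + C) = A * B + A * (C :: quat mat)"
  by (rule mult_add_distrib_mat[of A "dim_row A" "dim_row B" B "dim_col C" C]) auto

abbreviation rdiag :: "nat \<Rightarrow> (nat \<Rightarrow> real) \<Rightarrow> quat mat" where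
  "rdiag k d \<equiv> mat_diag k (\<lambda>i. of_real (d i))"

lemma dim_mat_diag [simp]: "dim_row (mat_diag k f) = k" "dim_col (mat_diag k f) = k"
  by (simp_all add: mat_diag_def)

lemma index_mat_diag [simp]:
  "i < k \<Longrightarrow> j < k \<Longrightarrow> mat_diag k f $$ (i,j) = (if i = j then f j else 0)"
  by (simp add: mat_diag_def)

lemma index_mult_mat_diag [simp]:
  "i < dim_row A \<Longrightarrow> j < k \<Longrightarrow> dim_col A = k \<Longrightarrow> (A * mat_diag k f) $$ (i,j) = A $$ (i,j) * f j"
  by (subst mat_diag_mult_right[of A "dim_row A"]) auto

lemma index_mat_diag_mult [simp]:
  "i < k \<Longrightarrow> j < dim_col A \<Longrightarrow> dim_row A = k \<Longrightarrow> (mat_diag k f * A) $$ (i,j) = f i * A $$ (i,j)"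
  by (subst mat_diag_mult_left[of A k "dim_col A"]) auto

lemma conj_transpose_rdiag [simp]: "conj_transpose (rdiag k d) = rdiag k d"
  by (rule eq_matI) auto

lemma gram_index:
  "dim_row X = dim_row Y \<Longrightarrow> i < dim_col X \<Longrightarrow> j < dim_col Y \<Longrightarrow>
   (conj_transpose X * Y) $$ (i,j) = (\<Sum>l<dim_row Y. conjugate (X $$ (l,i)) * Y $$ (l,j))"
  by (simp add: index_mult_mat_sum del: index_mult_mat(1))

lemma gram_diag:
  "i < dim_col X \<Longrightarrow> (conj_transpose X * X) $$ (i,i) = of_real (\<Sum>l<dim_row X. nsq (X $$ (l,i)))"
  by (simp add: gram_index conjugate_mult_self del: index_mult_mat(1))

lemma cogram_diag:
  "i < dim_row X \<Longrightarrow> (X * conj_transpose X) $$ (i,i) = of_real (\<Sum>l<dim_col X. nsq (X $$ (i,l)))"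
  using gram_diag[of i "conj_transpose X"] by simp

section \<open>The trace argument\<close>

text \<open>
  For \<open>Q\<^sup>* Q = Q\<close> the diagonal entry \<open>r\<close> is the squared norm of its column, to which it contributes
  \<open>r\<^sup>2\<close> itself. So \<open>r\<^sup>2 \<le> r\<close>, and if \<open>r = 1\<close> nothing remains for the other entries.
\<close>

lemma hermitian_idempotent_diag:
  assumes Q: "conj_transpose Q = (Q :: quat mat)" "Q * Q = Q" and i: "i < dim_row Q" and r: "Q $$ (i,i) = of_real r"
  shows "r \<le> 1" and "r = 1 \<Longrightarrow> l < dim_row Q \<Longrightarrow> l \<noteq> i \<Longrightarrow> Q $$ (l,i) = 0"
proof -
  have sq: "dim_col Q = dim_row Q"
    using Q(1) by (metis conj_transpose_dim(1))
  have "Q $$ (i,i) = of_real (\<Sum>l<dim_row Q. nsq (Q $$ (l,i)))"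
    using gram_diag[of i Q] Q i sq by simp
  then have "r = (\<Sum>l<dim_row Q. nsq (Q $$ (l,i)))"
    using r by (simp only: of_real_eq_iff)
  also have "\<dots> = r\<^sup>2 + (\<Sum>l\<in>{..<dim_row Q} - {i}. nsq (Q $$ (l,i)))"
    using i r by (simp add: sum.remove[of _ i])
  finally have eq: "r = r\<^sup>2 + (\<Sum>l\<in>{..<dim_row Q} - {i}. nsq (Q $$ (l,i)))" .
  moreover have "0 \<le> (\<Sum>l\<in>{..<dim_row Q} - {i}. nsq (Q $$ (l,i)))"
    by (simp add: sum_nonneg)
  ultimately have "r\<^sup>2 \<le> r"
    by linarith
  show "r \<le> 1"
  proof (rule ccontr)
    assume "\<not> r \<le> 1"
    then have "r * 1 < r * r"
      by (intro mult_strict_left_mono) auto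
    with \<open>r\<^sup>2 \<le> r\<close> show False
      by (simp add: power2_eq_square)
  qed
  show "Q $$ (l,i) = 0" if "r = 1" "l < dim_row Q" "l \<noteq> i"
  proof -
    have "(\<Sum>l\<in>{..<dim_row Q} - {i}. nsq (Q $$ (l,i))) = 0"
      using eq that by simp
    then show ?thesis
      using that by (subst (asm) sum_nonneg_eq_0_iff) auto
  qed
qed

lemma cogram_idempotent:
  assumes "X * (conj_transpose X * X) = (X :: quat mat)"
  shows "(X * conj_transpose X) * (X * conj_transpose X) = X * conj_transpose X"
proof -
  have "(X * conj_transpose X) * (X * conj_transpose X) = (X * (conj_transpose X * X)) * conj_transpose X"
    by (simp add: mult_mat_assoc)
  then show ?thesis
    using assms by simp
qed

text \<open>
  Bessel's inequality for the standard basis vectors: the row sums are the diagonal entries of the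
  projection \<open>X X\<^sup>*\<close>.
\<close>

lemma partial_isometry_row_le:
  assumes "X * (conj_transpose X * X) = X" and "j < dim_row X"
  shows "(\<Sum>i<dim_col X. nsq (X $$ (j,i))) \<le> 1"
  using hermitian_idempotent_diag(1)[of "X * conj_transpose X" j] cogram_diag[of j X]
    cogram_idempotent[OF assms(1)] assms(2)
  by (simp add: conj_transpose_mult del: index_mult_mat(1))

lemma gram_rdiag:
  assumes "conj_transpose X * X = rdiag k d" "dim_col X = k" "i < k"
  shows "d i = (\<Sum>l<dim_row X. nsq (X $$ (l,i)))"
proof -
  have "(of_real (d i) :: quat) = of_real (\<Sum>l<dim_row X. nsq (X $$ (l,i)))"
    using gram_diag[of i X] assms by simp
  then show ?thesis by (simp only: of_real_eq_iff)
qed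

lemma gram_rdiag_nonneg:
  assumes "conj_transpose X * X = rdiag k d" "dim_col X = k" "i < k"
  shows "0 \<le> d i"
  by (simp add: gram_rdiag[OF assms] sum_nonneg)

lemma real_card_filter: "real (card {i. i < (k :: nat) \<and> Q i}) = (\<Sum>i<k. if Q i then 1 else 0)"
proof -
  have "{i. i < k \<and> Q i} = {..<k} \<inter> {i. Q i}"
    by auto
  then show ?thesis
    by (subst sum.If_cases) simp_all
qed

text \<open>
  The nonzero columns of \<open>X\<close> are pairwise orthogonal, so this bounds the size of an orthogonal
  family. Normalizing them gives a partial isometry \<open>Y\<close>. The sum of the squared norms of its
  entries is the number of nonzero columns when taken by columns, and at most \<open>m\<close> when taken by
  rows.
\<close>

lemma card_support_gram_le:
  assumes X: "X \<in> carrier_mat m k" and gram: "conj_transpose X * X = rdiag k d"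
  shows "card {i. i < k \<and> d i \<noteq> 0} \<le> m"
proof -
  \<comment> \<open>Zero columns stay zero, so that \<open>Y\<^sup>* Y\<close> is a projection rather than the identity.\<close>
  define f where "f i = (if d i = 0 then 0 else 1 / sqrt (d i))" for i
  define Y where "Y = X * rdiag k f"
  have dim: "dim_row X = m" "dim_col X = k"
    using X by auto
  have d_nonneg: "0 \<le> d i" if "i < k" for i
    using gram_rdiag_nonneg[OF gram dim(2) that] .
  have YY: "conj_transpose Y * Y = rdiag k (\<lambda>i. if d i = 0 then 0 else 1)"
  proof -
    have "conj_transpose Y * Y = rdiag k f * (conj_transpose X * X) * rdiag k f"
      by (simp add: Y_def conj_transpose_mult dim mult_mat_assoc)
    also have "\<dots> = rdiag k (\<lambda>i. if d i = 0 then 0 else 1)"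
      unfolding gram
      by (rule eq_matI) (auto simp: f_def quat_eq_iff d_nonneg)
    finally show ?thesis .
  qed
  have dimY: "dim_row Y = m" "dim_col Y = k"
    by (simp_all add: Y_def dim)
  have Yiso: "Y * (conj_transpose Y * Y) = Y"
    unfolding YY by (rule eq_matI) (auto simp: Y_def dim f_def simp del: index_mult_mat(1))
  have "real (card {i. i < k \<and> d i \<noteq> 0}) = (\<Sum>i<k. if d i = 0 then 0 else 1)"
    unfolding real_card_filter by (intro sum.cong) auto
  also have "\<dots> = (\<Sum>i<k. \<Sum>j<m. nsq (Y $$ (j,i)))"
  proof (rule sum.cong)
    fix i assume "i \<in> {..<k}"
    then show "(if d i = 0 then 0 else 1) = (\<Sum>j<m. nsq (Y $$ (j,i)))"
      using gram_rdiag[OF YY dimY(2), of i] dimY by simp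
  qed simp
  also have "\<dots> = (\<Sum>j<m. \<Sum>i<k. nsq (Y $$ (j,i)))"
    by (rule sum.swap)
  also have "\<dots> \<le> (\<Sum>j<m. 1)"
    using partial_isometry_row_le[OF Yiso] dimY by (intro sum_mono) auto
  finally show ?thesis
    by simp
qed

lemma stiefelD:
  assumes "U \<in> stiefel n k"
  shows "dim_row U = n" "dim_col U = k" "conj_transpose U * U = 1\<^sub>m k"
  using assms by (auto simp: stiefel_def)

lemma stiefel_col_sum:
  assumes "U \<in> stiefel n k" "i < k"
  shows "(\<Sum>j<n. nsq (U $$ (j,i))) = 1"
  using gram_rdiag[of U k "\<lambda>_. 1" i] stiefelD[OF assms(1)] assms(2) by simp

text \<open>
  The rows of \<open>U\<close> have squared norms at most \<open>1\<close>, and these add up to \<open>k\<close> because the columns have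
  norm \<open>1\<close>. So all rows have norm \<open>1\<close>: the projection \<open>U U\<^sup>*\<close> has diagonal entries \<open>1\<close>, and
  therefore zeros elsewhere.
\<close>

lemma stiefel_square_right_inverse:
  assumes U: "U \<in> stiefel k k"
  shows "U * conj_transpose U = 1\<^sub>m k"
proof -
  note dim = stiefelD(1,2)[OF U]
  note inv = stiefelD(3)[OF U]
  define r where "r j = (\<Sum>i<k. nsq (U $$ (j,i)))" for j
  let ?Q = "U * conj_transpose U"
  have iso: "U * (conj_transpose U * U) = U"
    using U by (simp add: inv stiefel_def)
  have r_le: "r j \<le> 1" if "j < k" for j
    using partial_isometry_row_le[OF iso, of j] that dim by (simp add: r_def)
  have col: "(\<Sum>j<k. nsq (U $$ (j,i))) = 1" if "i < k" for i
    using stiefel_col_sum[OF U that] .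
  have "(\<Sum>j<k. r j) = (\<Sum>i<k. \<Sum>j<k. nsq (U $$ (j,i)))"
    unfolding r_def by (rule sum.swap)
  also have "\<dots> = (\<Sum>j<k. 1)"
    using col by simp
  finally have "(\<Sum>j<k. 1 - r j) = 0"
    by (simp add: sum_subtractf)
  then have r1: "r j = 1" if "j < k" for j
    using r_le that by (subst (asm) sum_nonneg_eq_0_iff) auto
  have Qd: "?Q $$ (j,j) = of_real 1" if "j < k" for j
    using cogram_diag[of j U] r1[OF that] that dim
    by (simp add: r_def del: of_real_sum index_mult_mat(1))
  have Qoff: "?Q $$ (l,j) = 0" if "l < k" "j < k" "l \<noteq> j" for l j
    using hermitian_idempotent_diag(2)[of ?Q j 1 l] cogram_idempotent[OF iso] Qd that dim
    by (simp add: conj_transpose_mult del: index_mult_mat(1))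
  show ?thesis
    using Qd Qoff dim by (intro eq_matI) (auto simp del: index_mult_mat(1))
qed

lemma stiefel_conj_transpose: "U \<in> stiefel k k \<Longrightarrow> conj_transpose U \<in> stiefel k k"
  using stiefel_square_right_inverse[of U k] by (auto simp: stiefel_def)

lemma stiefel_mult:
  assumes "U \<in> stiefel n k" "V \<in> stiefel k l"
  shows "U * V \<in> stiefel n l"
proof -
  have "conj_transpose (U * V) * (U * V) = conj_transpose V * ((conj_transpose U * U) * V)"
    using stiefelD(1,2)[OF assms(1)] stiefelD(1,2)[OF assms(2)]
    by (simp add: conj_transpose_mult mult_mat_assoc)
  also have "\<dots> = 1\<^sub>m l"
    using stiefelD[OF assms(1)] stiefelD[OF assms(2)] by simp
  finally show ?thesis
    using assms by (auto simp: stiefel_def)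
qed

lemma stiefel_row_sum:
  assumes "U \<in> stiefel k k" "j < k"
  shows "(\<Sum>i<k. nsq (U $$ (j,i))) = 1"
  using stiefel_col_sum[OF stiefel_conj_transpose[OF assms(1)] assms(2)] stiefelD[OF assms(1)] assms(2)
  by simp

section \<open>Existence of right eigenvectors\<close>

text \<open>
  Coordinates for \<open>\<bbbH> = \<complex> \<oplus> j \<complex>\<close> as a right vector space over \<open>\<complex>\<close>, where \<open>j\<close> is the second
  imaginary unit: \<open>q = cpart q + j jpart q\<close>. The minus sign reflects \<open>j i = - k\<close>. The map
  \<open>quat_of\<close> goes back.
\<close>

definition cpart :: "quat \<Rightarrow> complex" where
  "cpart q = Complex (QRe q) (QIm1 q)"

definition jpart :: "quat \<Rightarrow> complex" where
  "jpart q = Complex (QIm2 q) (- QIm3 q)"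

definition quat_of :: "complex \<Rightarrow> complex \<Rightarrow> quat" where
  "quat_of a b = Quat (Re a) (Im a) (Re b) (- Im b)"

lemma quat_of_add: "quat_of (a + a') (b + b') = quat_of a b + quat_of a' b'"
  by (simp add: quat_of_def quat_eq_iff)

lemma quat_of_sum: "quat_of (\<Sum>i\<in>I. f i) (\<Sum>i\<in>I. g i) = (\<Sum>i\<in>I. quat_of (f i) (g i))"
  by (induction I rule: infinite_finite_induct)
     (simp_all add: quat_of_add, simp_all add: quat_of_def quat_eq_iff)

text \<open>
  Left multiplication by \<open>p = \<alpha> + j \<beta>\<close> is linear over \<open>\<complex>\<close> acting from the right. As \<open>\<alpha> j = j cnj \<alpha>\<close>
  and \<open>j \<beta> j = - cnj \<beta>\<close>, its matrix has the rows \<open>(\<alpha>, - cnj \<beta>)\<close> and \<open>(\<beta>, cnj \<alpha>)\<close>.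
\<close>

lemma mult_quat_of:
  "p * quat_of a b = quat_of (cpart p * a - cnj (jpart p) * b) (jpart p * a + cnj (cpart p) * b)"
  by (simp add: quat_of_def cpart_def jpart_def quat_eq_iff algebra_simps)

lemma quat_of_mult_complex: "quat_of (a * c) (b * c) = quat_of a b * quat_of c 0"
  by (simp add: quat_of_def quat_eq_iff algebra_simps)

lemma quat_of_eq_0_iff: "quat_of a b = 0 \<longleftrightarrow> a = 0 \<and> b = 0"
  by (simp add: quat_of_def quat_eq_iff complex_eq_iff)

text \<open>
  The matrix of \<open>v \<mapsto> A v\<close> on \<open>\<bbbH>\<^sup>k = \<complex>\<^sup>k \<oplus> j \<complex>\<^sup>k\<close>, with the blocks of the preceding formula.
\<close>

definition complex_rep :: "nat \<Rightarrow> quat mat \<Rightarrow> complex mat" where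
  "complex_rep k A = mat (k + k) (k + k) (\<lambda>(i,j).
     if i < k then (if j < k then cpart (A $$ (i,j)) else - cnj (jpart (A $$ (i,j-k))))
     else (if j < k then jpart (A $$ (i-k,j)) else cnj (cpart (A $$ (i-k,j-k)))))"

lemma sum_lessThan_add:
  "(\<Sum>l<m+n. f l) = (\<Sum>l<m. f l) + (\<Sum>l<n. (f (m + l) :: 'a :: comm_monoid_add))"
  for m n :: nat
  by (induction n) (simp_all add: add.assoc)

text \<open>
  Vectors of \<open>\<bbbH>\<^sup>k\<close> are single-column matrices here, and a scalar acting from the right is a product
  with a \<open>1 \<times> 1\<close> matrix, so that the associativity of matrix products applies. The eigenvalue
  found is complex, the eigenvector being the quaternionic form of an eigenvector of
  \<open>complex_rep k A\<close>.
\<close>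

lemma right_eigenvector_exists:
  assumes A: "(A :: quat mat) \<in> carrier_mat k k" and "0 < k"
  obtains v \<mu> where "v \<in> carrier_mat k 1" "v \<noteq> 0\<^sub>m k 1" "A * v = v * mat_diag 1 (\<lambda>_. \<mu>)"
proof -
  let ?C = "complex_rep k A"
  have C: "?C \<in> carrier_mat (k + k) (k + k)"
    by (simp add: complex_rep_def)
  with \<open>0 < k\<close> obtain c where "eigenvalue ?C c"
    using spectrum_non_empty[OF C] by (auto simp: spectrum_def)
  then obtain z where zc: "z \<in> carrier_vec (k + k)" and z0: "z \<noteq> 0\<^sub>v (k + k)"
    and Cz: "?C *\<^sub>v z = c \<cdot>\<^sub>v z"
    unfolding eigenvalue_def eigenvector_def using C by auto
  have z: "dim_vec z = k + k" "z \<noteq> 0\<^sub>v (k + k)"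
    using zc z0 by auto
  define v where "v = mat k 1 (\<lambda>(i,j). quat_of (z $ i) (z $ (k + i)))"
  have ev: "(\<Sum>l<k. ?C $$ (i,l) * z $ l) + (\<Sum>l<k. ?C $$ (i,k+l) * z $ (k + l)) = c * z $ i"
    if "i < k + k" for i
  proof -
    have "(?C *\<^sub>v z) $ i = (\<Sum>l<k+k. ?C $$ (i,l) * z $ l)"
      using that z C by (auto simp: scalar_prod_def lessThan_atLeast0 intro!: sum.cong)
    then show ?thesis
      using Cz that z by (simp add: sum_lessThan_add)
  qed
  have Av: "(\<Sum>l<k. A $$ (i,l) * v $$ (l,0)) = v $$ (i,0) * quat_of c 0" if "i < k" for i
  proof -
    have 1: "(\<Sum>l<k. cpart (A $$ (i,l)) * z $ l - cnj (jpart (A $$ (i,l))) * z $ (k + l)) = z $ i * c"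
      using ev[of i] that
      by (simp add: complex_rep_def sum_subtractf sum_negf mult.commute)
    have 2: "(\<Sum>l<k. jpart (A $$ (i,l)) * z $ l + cnj (cpart (A $$ (i,l))) * z $ (k + l)) = z $ (k + i) * c"
      using ev[of "k + i"] that
      by (simp add: complex_rep_def sum.distrib mult.commute)
    have "(\<Sum>l<k. A $$ (i,l) * v $$ (l,0)) =
        (\<Sum>l<k. quat_of (cpart (A $$ (i,l)) * z $ l - cnj (jpart (A $$ (i,l))) * z $ (k + l))
                       (jpart (A $$ (i,l)) * z $ l + cnj (cpart (A $$ (i,l))) * z $ (k + l)))"
      by (simp add: v_def mult_quat_of)
    also have "\<dots> = v $$ (i,0) * quat_of c 0"
      using that by (simp only: quat_of_sum[symmetric] 1 2 quat_of_mult_complex) (simp add: v_def)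
    finally show ?thesis .
  qed
  show thesis
  proof
    show "v \<in> carrier_mat k 1"
      by (simp add: v_def)
    show "v \<noteq> 0\<^sub>m k 1"
    proof
      assume "v = 0\<^sub>m k 1"
      then have "v $$ (i,0) = 0" if "i < k" for i
        using that by simp
      then have "quat_of (z $ i) (z $ (k + i)) = 0" if "i < k" for i
        using that by (simp add: v_def)
      then have *: "z $ i = 0 \<and> z $ (k + i) = 0" if "i < k" for i
        using that by (simp add: quat_of_eq_0_iff)
      have "z $ i = 0" if "i < k + k" for i
        using *[of i] *[of "i - k"] that by (cases "i < k") auto
      with z show False
        by (auto simp: vec_eq_iff)
    qed
    show "A * v = v * mat_diag 1 (\<lambda>_. quat_of c 0)"
      using A Av
      by (intro eq_matI) (auto simp: v_def index_mult_mat_sum simp del: index_mult_mat(1))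
  qed
qed

lemma col_norm_pos:
  assumes "v \<in> carrier_mat k 1" "v \<noteq> 0\<^sub>m k 1"
  shows "0 < (\<Sum>l<k. nsq (v $$ (l,0)))"
proof -
  have "\<exists>i<k. v $$ (i,0) \<noteq> 0"
    using assms by (auto simp: mat_eq_iff)
  then obtain i where "i < k" "v $$ (i,0) \<noteq> 0"
    by blast
  then have "0 < nsq (v $$ (i,0))"
    by (metis nsq_nonneg nsq_eq_0_iff order_less_le)
  with \<open>i < k\<close> show ?thesis
    by (intro sum_pos2[of _ i]) auto
qed

text \<open>
  The \<open>1 \<times> 1\<close> matrix \<open>v\<^sup>* A v = v\<^sup>* v \<mu>\<close> is Hermitian, and \<open>v\<^sup>* v\<close> is a positive real.
\<close>

lemma hermitian_right_eigenvalue_real: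
  assumes A: "A \<in> carrier_mat k k" "conj_transpose A = A"
    and v: "v \<in> carrier_mat k 1" "v \<noteq> 0\<^sub>m k 1"
    and Av: "A * v = v * mat_diag 1 (\<lambda>_. \<mu>)"
  shows "\<mu> = of_real (QRe \<mu>)"
proof -
  define s where "s = (\<Sum>l<k. nsq (v $$ (l,0)))"
  have s: "s > 0"
    using col_norm_pos[OF v] by (simp add: s_def)
  have dim: "dim_row A = k" "dim_col A = k" "dim_row v = k" "dim_col v = 1"
    using A v by auto
  let ?g = "conj_transpose v * (A * v)"
  have "?g = (conj_transpose v * v) * mat_diag 1 (\<lambda>_. \<mu>)"
    by (simp add: Av mult_mat_assoc dim)
  then have g: "?g $$ (0,0) = of_real s * \<mu>"
    using gram_diag[of 0 v] dim by (simp add: s_def del: index_mult_mat(1) of_real_sum)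
  have "conj_transpose ?g = ?g"
    by (simp add: conj_transpose_mult mult_mat_assoc dim A(2))
  moreover have "conj_transpose ?g $$ (0,0) = conjugate (?g $$ (0,0))"
    by (rule conj_transpose_index) (simp_all add: dim)
  ultimately have "conjugate (of_real s * \<mu>) = of_real s * \<mu>"
    by (simp only: g)
  then have "of_real s * conjugate \<mu> = of_real s * \<mu>"
    by (simp only: conjugate_quat_mult conjugate_quat_of_real quat_of_real_commute[of s])
  then have "conjugate \<mu> = \<mu>"
    using s by simp
  then show ?thesis
    by (rule quat_eq_conjugateD)
qed

section \<open>The spectral theorem\<close>

text \<open>
  The reflection that exchanges a right multiple \<open>w\<close> of \<open>v\<close> and the first basis vector \<open>e\<close> is
  unitary and has first column \<open>w\<close>. A reflection in \<open>u = w - e\<close> maps \<open>e\<close> to \<open>w\<close> only if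
  both have the same norm and \<open>e\<^sup>* w\<close> is real, which the scalar \<open>c\<close> arranges. Choosing
  \<open>a = e\<^sup>* w \<le> 0\<close> keeps \<open>u\<close> away from zero, because \<open>u\<^sup>* u = 2 (1 - a)\<close>.
\<close>

lemma householder:
  assumes v: "v \<in> carrier_mat k 1" "v \<noteq> 0\<^sub>m k 1" and "0 < k"
  obtains H c where "H \<in> stiefel k k" "\<And>i. i < k \<Longrightarrow> H $$ (i,0) = v $$ (i,0) * c"
proof -
  define s where "s = (\<Sum>l<k. nsq (v $$ (l,0)))"
  have s: "s > 0"
    using col_norm_pos[OF v] by (simp add: s_def)
  \<comment> \<open>The conjugate makes the first entry of \<open>w\<close> real, and the sign makes it nonpositive. The default
    \<open>1\<close> keeps \<open>c\<close> nonzero when that entry vanishes.\<close>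
  define p where "p = (if v $$ (0,0) = 0 then 1 else - conjugate (v $$ (0,0)))"
  define c where "c = p * of_real (1 / sqrt (s * nsq p))"
  have p0: "p \<noteq> 0"
    by (simp add: p_def)
  then have p: "nsq p > 0"
    by (metis nsq_nonneg nsq_eq_0_iff order_less_le)
  have nsq_c: "nsq c = 1 / s"
    using s p p0 by (simp add: c_def nsq_mult power_divide)
  define a where "a = - nsq (v $$ (0,0)) / sqrt (s * nsq p)"
  have a: "a \<le> 0"
    using s p by (simp add: a_def)
  have v0: "v $$ (0,0) * c = of_real a"
  proof -
    have "v $$ (0,0) * p = of_real (- nsq (v $$ (0,0)))"
      by (simp add: p_def mult_conjugate_self)
    then have "v $$ (0,0) * c = of_real (- nsq (v $$ (0,0))) * of_real (1 / sqrt (s * nsq p))"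
      by (simp only: c_def mult.assoc[symmetric])
    then show ?thesis
      by (simp add: a_def flip: of_real_mult of_real_minus)
  qed
  define w where "w i = v $$ (i,0) * c" for i
  have w_norm: "(\<Sum>i<k. nsq (w i)) = 1"
    using s by (simp add: w_def nsq_mult nsq_c s_def flip: sum_divide_distrib)
  have w0: "w 0 = of_real a"
    by (simp add: w_def v0)
  define u where "u = mat k 1 (\<lambda>(i,j). if i = 0 then w i - 1 else w i)"
  \<comment> \<open>The factor is \<open>2 / (u\<^sup>* u)\<close>.\<close>
  define M where "M = u * rdiag 1 (\<lambda>_. 1 / (1 - a)) * conj_transpose u"
  define H where "H = 1\<^sub>m k - M"
  have dim_u: "dim_row u = k" "dim_col u = 1"
    by (simp_all add: u_def)
  have dim_M: "dim_row M = k" "dim_col M = k"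
    by (simp_all add: M_def dim_u)
  have M: "M \<in> carrier_mat k k"
    by (rule carrier_matI) (simp_all add: dim_M)
  have uu: "conj_transpose u * u = rdiag 1 (\<lambda>_. 2 * (1 - a))"
  proof -
    have split: "(\<Sum>i<k. f i) = f 0 + (\<Sum>i\<in>{..<k} - {0}. f i)" for f :: "nat \<Rightarrow> real"
      using \<open>0 < k\<close> by (intro sum.remove) auto
    have "(\<Sum>i<k. nsq (u $$ (i,0))) = nsq (w 0 - 1) + (\<Sum>i\<in>{..<k} - {0}. nsq (w i))"
      unfolding split[of "\<lambda>i. nsq (u $$ (i,0))"] using \<open>0 < k\<close> by (simp add: u_def)
    also have "\<dots> = nsq (w 0 - 1) + 1 - nsq (w 0)"
      using w_norm split[of "\<lambda>i. nsq (w i)"] by simp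
    also have "\<dots> = 2 * (1 - a)"
      by (simp add: w0 nsq_def power2_eq_square algebra_simps)
    finally have *: "(\<Sum>i<k. nsq (u $$ (i,0))) = 2 * (1 - a)" .
    have "(conj_transpose u * u) $$ (0,0) = of_real (2 * (1 - a))"
      using gram_diag[of 0 u] * by (simp only: dim_u zero_less_one)
    then show ?thesis
      by (intro eq_matI) (auto simp: dim_u simp del: index_mult_mat(1))
  qed
  have M_adj: "conj_transpose M = M"
    by (simp add: M_def conj_transpose_mult dim_u mult_mat_assoc)
  have "M * M = u * (rdiag 1 (\<lambda>_. 1 / (1 - a)) * (conj_transpose u * u) * rdiag 1 (\<lambda>_. 1 / (1 - a)))
      * conj_transpose u"
    by (simp add: M_def dim_u mult_mat_assoc)
  also have "rdiag 1 (\<lambda>_. 1 / (1 - a)) * (conj_transpose u * u) * rdiag 1 (\<lambda>_. 1 / (1 - a)) =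
      rdiag 1 (\<lambda>_. 1 / (1 - a)) + rdiag 1 (\<lambda>_. 1 / (1 - a))"
  proof -
    have "1 / (1 - a) * (2 * (1 - a)) * (1 / (1 - a)) = 1 / (1 - a) + 1 / (1 - a)"
    proof -
      have cancel: "1 / b * (2 * b) * (1 / b) = 1 / b + 1 / b" if "b \<noteq> 0" for b :: real
        using that by (simp add: field_simps)
      show ?thesis
        by (rule cancel) (use a in simp)
    qed
    then have "of_real (1 / (1 - a)) * of_real (2 * (1 - a)) * of_real (1 / (1 - a)) =
        (of_real (1 / (1 - a)) + of_real (1 / (1 - a)) :: quat)"
      by (simp only: of_real_mult[symmetric] of_real_add[symmetric])
    then have "rdiag 1 (\<lambda>_. 1 / (1 - a)) * (conj_transpose u * u) * rdiag 1 (\<lambda>_. 1 / (1 - a)) =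
        mat_diag 1 (\<lambda>_. of_real (1 / (1 - a)) + of_real (1 / (1 - a)))"
      by (simp only: uu mat_diag_diag)
    also have "\<dots> = rdiag 1 (\<lambda>_. 1 / (1 - a)) + rdiag 1 (\<lambda>_. 1 / (1 - a))"
      by (rule eq_matI) simp_all
    finally show ?thesis .
  qed
  also have "u * (rdiag 1 (\<lambda>_. 1 / (1 - a)) + rdiag 1 (\<lambda>_. 1 / (1 - a))) * conj_transpose u = M + M"
    unfolding M_def
    by (simp add: mult_add_mat_distrib add_mult_mat_distrib dim_u)
  finally have MM: "M * M = M + M" .
  have H_adj: "conj_transpose H = H"
    using dim_M by (simp add: H_def conj_transpose_diff M_adj)
  have "H * H = 1\<^sub>m k - M - (M - M * M)"
    unfolding H_def
    using M minus_mult_distrib_mat[OF one_carrier_mat M minus_carrier_mat[OF M], of "1\<^sub>m k"]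
      mult_minus_distrib_mat[OF M one_carrier_mat M] by simp
  also have "\<dots> = 1\<^sub>m k"
    unfolding MM using dim_M by (intro eq_matI) auto
  finally have "H \<in> stiefel k k"
    using minus_carrier_mat[OF M, of "1\<^sub>m k"] H_adj by (simp add: stiefel_def H_def)
  moreover have "H $$ (i,0) = v $$ (i,0) * c" if "i < k" for i
  proof -
    have "M $$ (i,0) = u $$ (i,0) * (of_real (1 / (1 - a)) * conjugate (u $$ (0,0)))"
      using that \<open>0 < k\<close> dim_u
      by (simp add: M_def mult_mat_assoc index_mult_mat_sum del: index_mult_mat(1))
    also have "of_real (1 / (1 - a)) * conjugate (u $$ (0,0)) = - 1"
      using a \<open>0 < k\<close> by (simp add: u_def w0 quat_eq_iff field_simps)
    finally have "M $$ (i,0) = - (u $$ (i,0))"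
      by simp
    then show ?thesis
      using that \<open>0 < k\<close> dim_M by (simp add: H_def u_def w_def)
  qed
  ultimately show thesis
    using that by blast
qed

text \<open>
  The change of basis that fixes the first basis vector and acts by \<open>U\<close> on the others.
\<close>

lemma four_block_stiefel:
  assumes U: "U \<in> stiefel k k"
  shows "four_block_mat (1\<^sub>m 1) (0\<^sub>m 1 k) (0\<^sub>m k 1) U \<in> stiefel (Suc k) (Suc k)"
proof -
  let ?F = "four_block_mat (1\<^sub>m 1) (0\<^sub>m 1 k) (0\<^sub>m k 1) U"
  have Uc: "U \<in> carrier_mat k k"
    using U by (simp add: stiefel_def)
  have "conj_transpose ?F = four_block_mat (1\<^sub>m 1) (0\<^sub>m 1 k) (0\<^sub>m k 1) (conj_transpose U)"
    using Uc by (intro eq_matI) auto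
  then have "conj_transpose ?F * ?F = four_block_mat (1\<^sub>m 1) (0\<^sub>m 1 k) (0\<^sub>m k 1) (1\<^sub>m k)"
    using Uc stiefelD(3)[OF U] by (simp add: mult_four_block_mat[of _ 1 1 _ k _ k _ _ 1 _ k])
  also have "\<dots> = 1\<^sub>m (Suc k)"
    by (rule eq_matI) auto
  finally show ?thesis
    using four_block_carrier_mat[of "1\<^sub>m 1" 1 1 U k k] Uc by (simp add: stiefel_def)
qed

text \<open>
  With \<open>H\<close> unitary and its first column an eigenvector, the first column of \<open>B = H\<^sup>* A H\<close> vanishes
  below the diagonal. As \<open>B\<close> is Hermitian, so does its first row to the right of the diagonal, and
  the induction hypothesis applies to the remaining block.
\<close>

theorem hermitian_diagonalization:
  assumes "A \<in> carrier_mat k k" "conj_transpose A = A"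
  shows "\<exists>U ds. orthonormal_diagonalization A U ds"
  using assms
proof (induction k arbitrary: A)
  case 0
  then have "orthonormal_diagonalization A (1\<^sub>m 0) []"
    by (auto simp: orthonormal_diagonalization_def stiefel_def)
  then show ?case by blast
next
  case (Suc k)
  obtain v \<mu> where v: "v \<in> carrier_mat (Suc k) 1" "v \<noteq> 0\<^sub>m (Suc k) 1"
    and Av: "A * v = v * mat_diag 1 (\<lambda>_. \<mu>)"
    using right_eigenvector_exists[OF Suc.prems(1)] by blast
  define r where "r = QRe \<mu>"
  have \<mu>: "\<mu> = of_real r"
    using hermitian_right_eigenvalue_real[OF Suc.prems v Av] by (simp add: r_def)
  obtain H c where H: "H \<in> stiefel (Suc k) (Suc k)"
    and H0: "\<And>i. i < Suc k \<Longrightarrow> H $$ (i,0) = v $$ (i,0) * c"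
    using householder[OF v] by blast
  note dimH = stiefelD(1,2)[OF H]
  have dimA: "dim_row A = Suc k" "dim_col A = Suc k"
    using Suc.prems by auto
  have HH: "H * conj_transpose H = 1\<^sub>m (Suc k)"
    by (rule stiefel_square_right_inverse[OF H])
  define B where "B = conj_transpose H * (A * H)"
  have B: "dim_row B = Suc k" "dim_col B = Suc k" "conj_transpose B = B"
    by (simp_all add: B_def dimH dimA conj_transpose_mult mult_mat_assoc Suc.prems(2))
  have AH0: "(A * H) $$ (i,0) = H $$ (i,0) * of_real r" if "i < Suc k" for i
  proof -
    have "(A * H) $$ (i,0) = (\<Sum>l<Suc k. A $$ (i,l) * v $$ (l,0)) * c"
      using that dimA dimH H0
      by (simp add: index_mult_mat_sum sum_distrib_right mult.assoc distrib_right del: index_mult_mat(1) sum.lessThan_Suc)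
    also have "(\<Sum>l<Suc k. A $$ (i,l) * v $$ (l,0)) = (A * v) $$ (i,0)"
      using that dimA v(1) by (simp add: index_mult_mat_sum del: index_mult_mat(1) sum.lessThan_Suc)
    also have "\<dots> = v $$ (i,0) * of_real r"
      using that v(1) by (simp add: Av \<mu> del: index_mult_mat(1))
    finally show ?thesis
      using H0[OF that] by (simp add: mult.assoc quat_of_real_commute)
  qed
  have B0: "B $$ (i,0) = (if i = 0 then of_real r else 0)" if "i < Suc k" for i
  proof -
    have "B $$ (i,0) = (conj_transpose H * H) $$ (i,0) * of_real r"
      unfolding B_def using that dimA dimH AH0
      by (simp add: gram_index sum_distrib_right mult.assoc distrib_right del: index_mult_mat(1) sum.lessThan_Suc)
    then show ?thesis
      using that by (simp add: stiefelD(3)[OF H])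
  qed
  have B0': "B $$ (0,i) = (if i = 0 then of_real r else 0)" if "i < Suc k" for i
  proof -
    have "B $$ (0,i) = conj_transpose B $$ (0,i)"
      by (simp add: B(3))
    also have "\<dots> = conjugate (B $$ (i,0))"
      by (rule conj_transpose_index) (use that B in simp_all)
    finally show ?thesis
      using B0[OF that] by simp
  qed
  define B' where "B' = mat k k (\<lambda>(i,j). B $$ (Suc i, Suc j))"
  have B': "B' \<in> carrier_mat k k"
    by (simp add: B'_def)
  have "conj_transpose B' = B'"
  proof (rule eq_matI)
    fix i j assume "i < dim_row B'" "j < dim_col B'"
    then have ij: "i < k" "j < k"
      by (simp_all add: B'_def)
    have "conj_transpose B' $$ (i,j) = conj_transpose B $$ (Suc i, Suc j)"
      using ij B(1,2) by (simp add: B'_def)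
    also have "\<dots> = B' $$ (i,j)"
      unfolding B(3) using ij by (simp add: B'_def)
    finally show "conj_transpose B' $$ (i,j) = B' $$ (i,j)" .
  qed (simp_all add: B'_def)
  then obtain U' ds where U': "U' \<in> stiefel k k" and ds: "length ds = k"
    and B'U': "B' * U' = U' * rdiag k (\<lambda>i. ds ! i)"
    using Suc.IH[OF B'] B' by (auto simp: orthonormal_diagonalization_def)
  have U'c: "U' \<in> carrier_mat k k"
    using U' by (simp add: stiefel_def)
  define F where "F = four_block_mat (1\<^sub>m 1) (0\<^sub>m 1 k) (0\<^sub>m k 1) U'"
  have F: "F \<in> stiefel (Suc k) (Suc k)"
    unfolding F_def by (rule four_block_stiefel[OF U'])
  note dimF = stiefelD(1,2)[OF F]
  let ?D = "rdiag (Suc k) (\<lambda>i. (r # ds) ! i)"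
  let ?r = "rdiag 1 (\<lambda>_. r)"
  have Bb: "B = four_block_mat ?r (0\<^sub>m 1 k) (0\<^sub>m k 1) B'"
    using B B0 B0' by (intro eq_matI) (auto simp: B'_def)
  have Db: "?D = four_block_mat ?r (0\<^sub>m 1 k) (0\<^sub>m k 1) (rdiag k (\<lambda>i. ds ! i))"
    by (rule eq_matI) auto
  have BF: "B * F = F * ?D"
    unfolding Bb Db F_def using B' U'c
    by (simp add: mult_four_block_mat[of _ 1 1 _ k _ k _ _ 1 _ k] B'U')
  have "A * (H * F) = (H * conj_transpose H) * (A * (H * F))"
    using dimA dimH dimF HH by simp
  also have "\<dots> = H * (B * F)"
    by (simp add: B_def dimA dimH dimF mult_mat_assoc)
  also have "\<dots> = (H * F) * ?D"
    unfolding BF by (simp add: dimH dimF mult_mat_assoc)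
  finally have "orthonormal_diagonalization A (H * F) (r # ds)"
    using stiefel_mult[OF H F] dimA ds by (simp add: orthonormal_diagonalization_def)
  then show ?case by blast
qed

lemma orthonormal_diagonalizationD:
  assumes "orthonormal_diagonalization A U ds" "A \<in> carrier_mat k k"
  shows "length ds = k" "U \<in> stiefel k k" "A * U = U * rdiag k (\<lambda>i. ds ! i)"
    "conj_transpose U * A = rdiag k (\<lambda>i. ds ! i) * conj_transpose U"
    "conj_transpose U * (A * U) = rdiag k (\<lambda>i. ds ! i)"
proof -
  show *: "length ds = k" "U \<in> stiefel k k" "A * U = U * rdiag k (\<lambda>i. ds ! i)"
    using assms by (auto simp: orthonormal_diagonalization_def)
  note dim = stiefelD[OF *(2)]
  have dimA: "dim_row A = k" "dim_col A = k"
    using assms by auto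
  show D: "conj_transpose U * (A * U) = rdiag k (\<lambda>i. ds ! i)"
    unfolding *(3) using dim by (simp add: mult_mat_assoc[symmetric])
  have "conj_transpose U * A = conj_transpose U * A * (U * conj_transpose U)"
    using stiefel_square_right_inverse[OF *(2)] dim dimA by simp
  also have "\<dots> = conj_transpose U * (A * U) * conj_transpose U"
    using dim dimA by (simp add: mult_mat_assoc)
  finally show "conj_transpose U * A = rdiag k (\<lambda>i. ds ! i) * conj_transpose U"
    unfolding D .
qed

lemma count_mset_conv_card: "count (mset xs) x = card {i. i < length xs \<and> xs ! i = x}"
  by (simp add: count_mset count_list_eq_length_filter length_filter_conv_card eq_commute)

text \<open>
  The transition matrix \<open>W\<close> satisfies \<open>D W = W E\<close>, so \<open>w\<^sub>i\<^sub>j\<close> vanishes unless \<open>d\<^sub>i = e\<^sub>j\<close>. Its squared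
  norms have row and column sums \<open>1\<close>. Summing them over the rows with \<open>d\<^sub>i = r\<close> is therefore the same
  as summing over the columns with \<open>e\<^sub>j = r\<close>, and the two sums count how often \<open>r\<close> occurs in
  \<open>ds\<close> and in \<open>es\<close>.
\<close>

lemma orthonormal_diagonalization_unique:
  assumes A: "A \<in> carrier_mat k k"
    and U: "orthonormal_diagonalization A U ds" and V: "orthonormal_diagonalization A V es"
  shows "mset ds = mset es"
proof (rule multiset_eqI)
  fix r
  note U = orthonormal_diagonalizationD[OF U A] and V = orthonormal_diagonalizationD[OF V A]
  note dim = stiefelD(1,2)[OF U(2)] stiefelD(1,2)[OF V(2)]
  have dimA: "dim_row A = k" "dim_col A = k"
    using A by auto
  define W where "W = conj_transpose U * V"
  have W: "W \<in> stiefel k k"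
    unfolding W_def by (intro stiefel_mult[of _ k k] stiefel_conj_transpose U V)
  note dimW = stiefelD(1,2)[OF W]
  have "rdiag k (\<lambda>i. ds ! i) * W = conj_transpose U * A * V"
    unfolding U(4) W_def by (simp add: mult_mat_assoc dim)
  also have "\<dots> = W * rdiag k (\<lambda>i. es ! i)"
    unfolding W_def by (simp add: mult_mat_assoc dim dimA V(3))
  finally have DW: "rdiag k (\<lambda>i. ds ! i) * W = W * rdiag k (\<lambda>i. es ! i)" .
  have link: "W $$ (i,j) = 0 \<or> ds ! i = es ! j" if "i < k" "j < k" for i j
  proof -
    have "of_real (ds ! i) * W $$ (i,j) = W $$ (i,j) * of_real (es ! j)"
      using DW that dimW by (metis index_mat_diag_mult index_mult_mat_diag)
    then have "(ds ! i) *\<^sub>R W $$ (i,j) = (es ! j) *\<^sub>R W $$ (i,j)"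
      by (simp add: scaleR_conv_of_real quat_of_real_commute)
    then show ?thesis
      by auto
  qed
  have "real (card {i. i < k \<and> ds ! i = r}) = (\<Sum>i<k. (if ds ! i = r then 1 else 0) * (\<Sum>j<k. nsq (W $$ (i,j))))"
    using stiefel_row_sum[OF W] by (simp add: real_card_filter)
  also have "\<dots> = (\<Sum>i<k. \<Sum>j<k. (if es ! j = r then 1 else 0) * nsq (W $$ (i,j)))"
    unfolding sum_distrib_left using link by (intro sum.cong) force+
  also have "\<dots> = (\<Sum>j<k. (if es ! j = r then 1 else 0) * (\<Sum>i<k. nsq (W $$ (i,j))))"
    unfolding sum_distrib_left by (rule sum.swap)
  also have "\<dots> = real (card {j. j < k \<and> es ! j = r})"
    using stiefel_col_sum[OF W] by (simp add: real_card_filter)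
  finally show "count (mset ds) r = count (mset es) r"
    by (simp add: count_mset_conv_card U(1) V(1))
qed

lemma real_spectrum_eq:
  assumes "A \<in> carrier_mat k k" "orthonormal_diagonalization A U ds"
  shows "real_spectrum A = mset ds"
  unfolding real_spectrum_def
  using assms orthonormal_diagonalization_unique[OF assms(1)] by (intro the_equality) blast+

lemma mult_mat_vec_map_right:
  assumes "dim_col M = dim_vec v"
  shows "M *\<^sub>v map_vec (\<lambda>x. x * \<mu>) v = map_vec (\<lambda>x. x * (\<mu> :: quat)) (M *\<^sub>v v)"
  using assms by (intro eq_vecI) (auto simp: scalar_prod_def sum_distrib_right mult.assoc)

text \<open>
  In the coordinates \<open>w = U\<^sup>* v\<close> the eigenvalue equation reads \<open>d\<^sub>i w\<^sub>i = w\<^sub>i \<mu>\<close>. The reals \<open>d\<^sub>i\<close> are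
  central, so a nonzero coordinate forces \<open>\<mu> = d\<^sub>i\<close>. A central eigenvalue is the only element of its
  conjugacy class, which is why no other quaternion can occur.
\<close>

lemma right_eigenvalue_iff_diagonal:
  assumes A: "A \<in> carrier_mat k k" and diag: "orthonormal_diagonalization A U ds"
  shows "right_eigenvalue A \<mu> \<longleftrightarrow> \<mu> \<in> of_real ` set ds"
proof
  note U = orthonormal_diagonalizationD[OF diag A]
  note dim = stiefelD(1,2)[OF U(2)]
  have dimA: "dim_row A = k" "dim_col A = k"
    using A by auto
  have Uc: "U \<in> carrier_mat k k"
    using dim by auto
  {
    assume "right_eigenvalue A \<mu>"
    then obtain v where v: "v \<in> carrier_vec k" "v \<noteq> 0\<^sub>v k" and Av: "A *\<^sub>v v = map_vec (\<lambda>x. x * \<mu>) v"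
      by (auto simp: right_eigenvalue_def dimA)
    define w where "w = conj_transpose U *\<^sub>v v"
    have w: "w \<in> carrier_vec k"
      unfolding w_def by (rule carrier_vecI) (simp add: dim)
    have "U *\<^sub>v w = (U * conj_transpose U) *\<^sub>v v"
      unfolding w_def using Uc v by (intro assoc_mult_mat_vec[symmetric]) auto
    then have Uw: "U *\<^sub>v w = v"
      using stiefel_square_right_inverse[OF U(2)] v by simp
    have "w \<noteq> 0\<^sub>v k"
      using Uw v Uc by auto
    then obtain i where i: "i < k" "w $ i \<noteq> 0"
      using w by (auto simp: vec_eq_iff)
    have "rdiag k (\<lambda>i. ds ! i) *\<^sub>v w = (conj_transpose U * A) *\<^sub>v v"
      unfolding w_def U(4) using Uc v by (intro assoc_mult_mat_vec[symmetric]) auto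
    also have "\<dots> = conj_transpose U *\<^sub>v map_vec (\<lambda>x. x * \<mu>) v"
      using Uc A v by (subst assoc_mult_mat_vec[of _ k k _ k]) (auto simp: Av)
    also have "\<dots> = map_vec (\<lambda>x. x * \<mu>) w"
      unfolding w_def using v dim by (intro mult_mat_vec_map_right) auto
    finally have "(rdiag k (\<lambda>i. ds ! i) *\<^sub>v w) $ i = w $ i * \<mu>"
      using i w by simp
    moreover have "(rdiag k (\<lambda>i. ds ! i) *\<^sub>v w) $ i = of_real (ds ! i) * w $ i"
    proof -
      have "(rdiag k (\<lambda>i. ds ! i) *\<^sub>v w) $ i = (\<Sum>l<k. rdiag k (\<lambda>i. ds ! i) $$ (i,l) * w $ l)"
        using i w by (auto simp: scalar_prod_def lessThan_atLeast0 simp del: index_mat_diag intro!: sum.cong)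
      also have "\<dots> = (\<Sum>l<k. if l = i then of_real (ds ! i) * w $ i else 0)"
        using i by (intro sum.cong) auto
      finally show ?thesis
        using i by simp
    qed
    ultimately have "w $ i * of_real (ds ! i) = w $ i * \<mu>"
      by (simp only: quat_of_real_commute)
    then have "\<mu> = of_real (ds ! i)"
      using i by simp
    then show "\<mu> \<in> of_real ` set ds"
      using i U(1) by auto
  next
    assume "\<mu> \<in> of_real ` set ds"
    then obtain i where i: "i < k" "\<mu> = of_real (ds ! i)"
      using U(1) by (auto simp: in_set_conv_nth)
    have "A *\<^sub>v col U i = col (U * rdiag k (\<lambda>i. ds ! i)) i"
      using i dim by (simp only: U(3)[symmetric] col_mult2[OF A Uc])
    also have "\<dots> = map_vec (\<lambda>x. x * \<mu>) (col U i)"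
      using i dim by (intro eq_vecI) (auto simp del: index_mult_mat(1))
    finally have "A *\<^sub>v col U i = map_vec (\<lambda>x. x * \<mu>) (col U i)" .
    moreover have "col U i \<noteq> 0\<^sub>v k"
    proof
      assume 0: "col U i = 0\<^sub>v k"
      have "U $$ (j,i) = 0" if "j < k" for j
        using arg_cong[OF 0, of "\<lambda>v. v $ j"] that i dim by simp
      with stiefel_col_sum[OF U(2) i(1)] show False
        by simp
    qed
    ultimately show "right_eigenvalue A \<mu>"
      unfolding right_eigenvalue_def dimA by (intro bexI[of _ "col U i"] carrier_vecI) (simp_all add: dim)
  }
qed

section \<open>Admissibility as a Gram matrix problem\<close>

lemma append_rows_gram:
  assumes T: "T \<in> carrier_mat m k" and P: "P \<in> carrier_mat l k"
  shows "conj_transpose (T @\<^sub>r P) * (T @\<^sub>r P) = conj_transpose T * T + conj_transpose P * (P :: quat mat)"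
proof (rule eq_matI)
  have dim: "dim_row T = m" "dim_col T = k" "dim_row P = l" "dim_col P = k"
    "dim_row (T @\<^sub>r P) = m + l" "dim_col (T @\<^sub>r P) = k"
    using T P by (auto simp: append_rows_def)
  then show "dim_row (conj_transpose (T @\<^sub>r P) * (T @\<^sub>r P)) = dim_row (conj_transpose T * T + conj_transpose P * P)"
    "dim_col (conj_transpose (T @\<^sub>r P) * (T @\<^sub>r P)) = dim_col (conj_transpose T * T + conj_transpose P * P)"
    by auto
  fix i j assume "i < dim_row (conj_transpose T * T + conj_transpose P * P)"
    "j < dim_col (conj_transpose T * T + conj_transpose P * P)"
  then have ij: "i < k" "j < k"
    using dim by auto
  have "(T @\<^sub>r P) $$ (a,b) = (if a < m then T $$ (a,b) else P $$ (a - m,b))" if "a < m + l" "b < k" for a b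
    using that dim by (simp add: append_rows_def)
  then show "(conj_transpose (T @\<^sub>r P) * (T @\<^sub>r P)) $$ (i,j) = (conj_transpose T * T + conj_transpose P * P) $$ (i,j)"
    using ij dim by (simp add: gram_index sum_lessThan_add del: index_mult_mat(1))
qed

lemma admissible_iff_gram:
  assumes "k \<le> n" "P \<in> carrier_mat k k"
  shows "admissible n k P \<longleftrightarrow>
    (\<exists>T \<in> carrier_mat (n - k) k. conj_transpose T * T + conj_transpose P * P = 1\<^sub>m k)"
proof -
  have "T @\<^sub>r P \<in> carrier_mat n k" if "T \<in> carrier_mat (n - k) k" for T
    using carrier_append_rows[OF that assms(2)] assms(1) by simp
  then show ?thesis
    using assms by (auto simp: admissible_def stiefel_def append_rows_gram)
qed

text \<open>
  The columns of \<open>R\<close> with \<open>d\<^sub>i \<noteq> 0\<close> are the multiples by \<open>sqrt d\<^sub>i\<close> of distinct standard basis vectors,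
  selected by an injection \<open>f\<close> into the row indices.
\<close>

lemma rdiag_gram_exists:
  assumes d: "\<And>i. i < k \<Longrightarrow> 0 \<le> d i" and card: "card {i. i < k \<and> d i \<noteq> 0} \<le> m"
  obtains R where "R \<in> carrier_mat m k" "conj_transpose R * R = rdiag k d"
proof -
  let ?S = "{i. i < k \<and> d i \<noteq> 0}"
  obtain f where f: "f ` ?S \<subseteq> {..<m}" "inj_on f ?S"
    using card_le_inj[of ?S "{..<m}"] card by auto
  define R :: "quat mat" where
    "R = mat m k (\<lambda>(l,i). if d i \<noteq> 0 \<and> f i = l then of_real (sqrt (d i)) else 0)"
  have R: "dim_row R = m" "dim_col R = k"
    by (simp_all add: R_def)
  have "(conj_transpose R * R) $$ (i,j) = rdiag k d $$ (i,j)" if ij: "i < k" "j < k" for i j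
  proof -
    have "(conj_transpose R * R) $$ (i,j) = (\<Sum>l<m. conjugate (R $$ (l,i)) * R $$ (l,j))"
      using ij R by (simp only: gram_index)
    also have "\<dots> = (\<Sum>l<m. if l = f i then
        (if d i \<noteq> 0 \<and> d j \<noteq> 0 \<and> f i = f j then of_real (sqrt (d i)) * of_real (sqrt (d j)) else 0) else 0)"
      by (rule sum.cong) (use ij in \<open>auto simp: R_def\<close>)
    also have "\<dots> = (if d i \<noteq> 0 \<and> d j \<noteq> 0 \<and> f i = f j then of_real (sqrt (d i)) * of_real (sqrt (d j)) else 0)"
      using f(1) ij by (auto simp: sum.delta)
    also have "\<dots> = rdiag k d $$ (i,j)"
      using inj_onD[OF f(2), of i j] ij d[of i] by (auto simp flip: of_real_mult)
    finally show ?thesis .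
  qed
  then have "conj_transpose R * R = rdiag k d"
    using R by (intro eq_matI) (auto simp del: index_mult_mat(1))
  with R that show thesis
    by blast
qed

text \<open>
  Passing to the eigenbasis \<open>U\<close> turns \<open>T\<^sup>* T = I - P\<^sup>* P\<close> into \<open>W\<^sup>* W = I - D\<close> for \<open>W = T U\<close>, a Gram
  problem for a diagonal matrix.
\<close>

lemma gram_complement_exists_iff:
  assumes P: "P \<in> carrier_mat k k"
    and diag: "orthonormal_diagonalization (conj_transpose P * P) U ds"
  shows "(\<exists>T \<in> carrier_mat m k. conj_transpose T * T + conj_transpose P * P = 1\<^sub>m k) \<longleftrightarrow>
    (\<forall>i<k. ds ! i \<in> {0..1}) \<and> card {i. i < k \<and> ds ! i \<noteq> 1} \<le> m"
proof
  define A where "A = conj_transpose P * P"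
  have A: "A \<in> carrier_mat k k"
    unfolding A_def using P by (intro mult_carrier_mat[of _ k k]) auto
  note U = orthonormal_diagonalizationD[OF diag[folded A_def] A]
  note dim = stiefelD[OF U(2)]
  have dimA: "dim_row A = k" "dim_col A = k" and dimP: "dim_row P = k" "dim_col P = k"
    using A P by auto
  let ?D = "rdiag k (\<lambda>i. ds ! i)" and ?E = "rdiag k (\<lambda>i. 1 - ds ! i)"
  have supp: "{i. i < k \<and> ds ! i \<noteq> 1} = {i. i < k \<and> 1 - ds ! i \<noteq> 0}"
    by auto
  have DE: "?E + ?D = 1\<^sub>m k"
    by (rule eq_matI) (auto simp flip: of_real_add)
  {
    assume "\<exists>T \<in> carrier_mat m k. conj_transpose T * T + conj_transpose P * P = 1\<^sub>m k"
    then obtain T where T: "T \<in> carrier_mat m k" and TA: "conj_transpose T * T + A = 1\<^sub>m k"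
      by (auto simp: A_def)
    have dimT: "dim_row T = m" "dim_col T = k"
      using T by auto
    define W where "W = T * U"
    have dimW: "dim_row W = m" "dim_col W = k"
      by (simp_all add: W_def dim dimT)
    have "1\<^sub>m k = conj_transpose U * ((conj_transpose T * T + A) * U)"
      using dim by (simp add: TA)
    also have "(conj_transpose T * T + A) * U = conj_transpose T * T * U + A * U"
      by (rule add_mult_mat_distrib) (simp_all add: dim(1,2) dimT dimA)
    also have "conj_transpose U * (conj_transpose T * T * U + A * U) =
        conj_transpose U * (conj_transpose T * T * U) + conj_transpose U * (A * U)"
      by (rule mult_add_mat_distrib) (simp_all add: dim(1,2) dimT dimA)
    also have "\<dots> = conj_transpose W * W + ?D"
      unfolding U(5) by (simp add: W_def conj_transpose_mult mult_mat_assoc dim dimT)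
    finally have sum: "conj_transpose W * W + ?D = 1\<^sub>m k" by simp
    have WW: "conj_transpose W * W = ?E"
    proof (rule eq_matI)
      fix i j assume "i < dim_row ?E" "j < dim_col ?E"
      then have ij: "i < k" "j < k" by simp_all
      have "(conj_transpose W * W + ?D) $$ (i,j) = (conj_transpose W * W) $$ (i,j) + ?D $$ (i,j)"
        using ij by (intro index_add_mat) simp_all
      then have "(conj_transpose W * W) $$ (i,j) = 1\<^sub>m k $$ (i,j) - ?D $$ (i,j)"
        unfolding sum by (simp add: algebra_simps)
      then show "(conj_transpose W * W) $$ (i,j) = ?E $$ (i,j)"
        using ij by auto
    qed (simp_all add: dimW)
    \<comment> \<open>Nonnegativity of \<open>D\<close> comes from \<open>P\<close> itself, and that of \<open>I - D\<close> from \<open>T\<close>.\<close>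
    have PP: "conj_transpose (P * U) * (P * U) = ?D"
      using U(5) by (simp add: A_def conj_transpose_mult mult_mat_assoc dim dimP)
    have "ds ! i \<in> {0..1}" if "i < k" for i
      using gram_rdiag_nonneg[OF PP _ that] gram_rdiag_nonneg[OF WW dimW(2) that] dim by simp
    moreover have "W \<in> carrier_mat m k"
      by (rule carrier_matI) (simp_all add: dimW)
    then have "card {i. i < k \<and> ds ! i \<noteq> 1} \<le> m"
      unfolding supp by (rule card_support_gram_le[OF _ WW])
    ultimately show "(\<forall>i<k. ds ! i \<in> {0..1}) \<and> card {i. i < k \<and> ds ! i \<noteq> 1} \<le> m"
      by blast
  next
    assume *: "(\<forall>i<k. ds ! i \<in> {0..1}) \<and> card {i. i < k \<and> ds ! i \<noteq> 1} \<le> m"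
    then have "\<And>i. i < k \<Longrightarrow> 0 \<le> 1 - ds ! i" "card {i. i < k \<and> 1 - ds ! i \<noteq> 0} \<le> m"
      by simp_all
    then obtain R where R: "R \<in> carrier_mat m k" and RR: "conj_transpose R * R = ?E"
      using rdiag_gram_exists[of k "\<lambda>i. 1 - ds ! i" m] by blast
    have dimR: "dim_row R = m" "dim_col R = k"
      using R by auto
    define T where "T = R * conj_transpose U"
    have "conj_transpose T * T = U * (conj_transpose R * R * conj_transpose U)"
      by (simp add: T_def conj_transpose_mult mult_mat_assoc dim dimR)
    moreover have "A = A * (U * conj_transpose U)"
      using stiefel_square_right_inverse[OF U(2)] dimA by simp
    then have "A = U * (?D * conj_transpose U)"
      using U(3) dim dimA by (simp add: mult_mat_assoc[symmetric])
    ultimately have "conj_transpose T * T + A = U * (?E * conj_transpose U) + U * (?D * conj_transpose U)"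
      using RR by simp
    also have "\<dots> = U * (?E * conj_transpose U + ?D * conj_transpose U)"
      by (rule mult_add_mat_distrib[symmetric]) (simp_all add: dim(1,2))
    also have "?E * conj_transpose U + ?D * conj_transpose U = (?E + ?D) * conj_transpose U"
      by (rule add_mult_mat_distrib[symmetric]) (simp_all add: dim(1,2))
    also have "U * ((?E + ?D) * conj_transpose U) = 1\<^sub>m k"
      unfolding DE using stiefel_square_right_inverse[OF U(2)] dim by simp
    finally have "conj_transpose T * T + conj_transpose P * P = 1\<^sub>m k"
      by (simp add: A_def)
    moreover have "T \<in> carrier_mat m k"
      by (rule carrier_matI) (simp_all add: T_def dim dimR)
    ultimately show "\<exists>T \<in> carrier_mat m k. conj_transpose T * T + conj_transpose P * P = 1\<^sub>m k"
      by blast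
  }
qed

theorem proposition2p2:
  fixes n k :: nat and P :: "quat mat"
  assumes "0 < k" and "k \<le> n" and "P \<in> carrier_mat k k"
  shows "admissible n k P \<longleftrightarrow>
    (\<forall>\<mu>. right_eigenvalue (conj_transpose P * P) \<mu> \<longrightarrow> \<mu> \<in> of_real ` {0..1}) \<and>
    int (eigenvalue_multiplicity (conj_transpose P * P) 1) \<ge> 2 * int k - int n"
proof -
  let ?A = "conj_transpose P * P"
  have dimP: "dim_row P = k" "dim_col P = k"
    using assms by auto
  have A: "?A \<in> carrier_mat k k"
    by (rule carrier_matI) (simp_all add: dimP)
  have "conj_transpose ?A = ?A"
    by (simp add: conj_transpose_mult dimP)
  then obtain U ds where diag: "orthonormal_diagonalization ?A U ds"
    using hermitian_diagonalization[OF A] by blast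
  have len: "length ds = k"
    using orthonormal_diagonalizationD(1)[OF diag A] .
  have eig: "(\<forall>\<mu>. right_eigenvalue ?A \<mu> \<longrightarrow> \<mu> \<in> of_real ` {0..1}) \<longleftrightarrow> (\<forall>i<k. ds ! i \<in> {0..1})"
  proof -
    have "(\<forall>\<mu>. right_eigenvalue ?A \<mu> \<longrightarrow> \<mu> \<in> of_real ` {0..1}) \<longleftrightarrow>
        (of_real ` set ds :: quat set) \<subseteq> of_real ` {0..1}"
      by (auto simp: right_eigenvalue_iff_diagonal[OF A diag])
    also have "\<dots> \<longleftrightarrow> set ds \<subseteq> {0..1}"
      by (intro inj_image_subset_iff injI) simp
    also have "\<dots> \<longleftrightarrow> (\<forall>i<k. ds ! i \<in> {0..1})"
      by (auto simp: subset_iff in_set_conv_nth len)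
    finally show ?thesis .
  qed
  have "eigenvalue_multiplicity ?A 1 = card {i. i < k \<and> ds ! i = 1}"
    by (simp add: eigenvalue_multiplicity_def real_spectrum_eq[OF A diag] count_mset_conv_card len)
  moreover have "card {i. i < k \<and> ds ! i = 1} + card {i. i < k \<and> ds ! i \<noteq> 1} = k"
    by (subst card_Un_disjoint[symmetric]) (auto intro!: arg_cong[where f = card, of _ "{..<k}", simplified])
  ultimately have mult: "int (eigenvalue_multiplicity ?A 1) \<ge> 2 * int k - int n \<longleftrightarrow>
      card {i. i < k \<and> ds ! i \<noteq> 1} \<le> n - k"
    using assms(2) by linarith
  show ?thesis
    unfolding admissible_iff_gram[OF assms(2,3)] gram_complement_exists_iff[OF assms(3) diag] eig mult ..
qed

end
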